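(* If $\mathcal{I}$ is a non-pathological analytic P-ideal on $\omega$, then there are a Banach space $X\subseteq\mathbb{R}^\omega$ (a linear subspace with coordinatewise operations, equipped with some complete norm) and $\hat{a}\subseteq X\times X^\star$ simple over $\hat{e}$ such that $\mathcal{CR}(X,\hat{a})=\mathcal{I}$. Here $\hat{e}=(e_n,e_n^\star)$ consists of the standard unit vectors and the coordinate functionals.
   Context: $\omega=\{0,1,2,\dots\}$. An ideal on $\omega$ is a family $\mathcal{I}\subseteq\mathcal{P}(\omega)$ containing all finite sets and closed under subsets and finite unions. $\mathcal{I}$ is a P-ideal if for each sequence $(A_n)\subseteq\mathcal{I}$ there is $A\in\mathcal{I}$ with $A_n\setminus A$ finite for all $n$. Analyticity refers to the product topology on $2^\omega\cong\mathcal{P}(\omega)$. A submeasure is $\phi:\mathcal{P}(\omega)\to[0,\infty]$ with $\phi(\emptyset)=0$, $\phi(\{n\})<\infty$ for all $n$, and $\phi(A)\le\phi(A\cup B)\le\phi(A)+\phi(B)$. It is lower semicontinuous (lsc) if $\phi(A)=\lim_n\phi(A\cap\{0,\dots,n-1\})$ for all $A$. $\mathrm{Exh}(\phi)=\{A\subseteq\omega:\lim_{n\to\infty}\phi(A\setminus\{0,\dots,n-1\})=0\}$. (Analytic P-ideals are exactly the ideals $\mathrm{Exh}(\phi)$ with $\phi$ lsc and $\omega\notin\mathrm{Exh}(\phi)$.) $\phi$ is non-pathological if $\phi(A)=\sup\{\mu(A):\mu$ is a measure on $\mathcal{P}(\omega)$ with $\mathrm{supp}(\mu)=\{n:\mu(\{n\})\ne0\}$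 finite and $\mu(B)\le\phi(B)$ for all $B\subseteq\omega\}$ for all $A\subseteq\omega$. An analytic P-ideal is non-pathological if it equals $\mathrm{Exh}(\phi)$ for some non-pathological lsc submeasure $\phi$. Let $X$ be a Banach space with scalar field $\mathbb{K}$ and continuous dual $X^\star$. All sequences of pairs $\hat{a}=(a_n,a_n^\star)_{n\in\omega}$ with $a_n\in X$, $a_n^\star:X\to\mathbb{K}$ are assumed biorthogonal: $a_n^\star(a_m)=\delta_{nm}$. Put $S_n(\hat{a})(x)=\sum_{i=0}^n a_i^\star(x)a_i$. For an ideal $\mathcal{I}$ on $\omega$, $\hat{a}$ is an $\mathcal{I}$-Schauder basis of $X$ if $\{n\in\omega:\|x-S_n(\hat{a})(x)\|_X\ge\varepsilon\}\in\mathcal{I}$ for all $x\in X$, $\varepsilon>0$. The critical ideal $\mathcal{CR}(X,\hat{a})$ is the (unique, possibly trivial) ideal on $\omega$ such that for every ideal $\mathcal{I}$ on $\omega$: $\hat{a}$ is an $\mathcal{I}$-Schauder basis of $X$ iff $\mathcal{CR}(X,\hat{a})\subseteq\mathcal{I}$. $\hat{a}\subseteq X\times X^\star$ is simple over $\hat{u}\subseteq X\times X^\star$ if there are $D\subseteq\omega$, a function $h:D\to\omega$ that is interval-to-one (each $h^{-1}[\{k\}]$ is empty or an interval of $\omega$ contained in $D$), and vectors $(b_k)_{k\in h[D]}\subseteq X\setminus\{0\}$ such that for all $x\in X$: $S_n(\hat{u})(x)-S_n(\hat{a})(x)=0$ if $n\in\omega\setminus D$, and $=u_{h(n)}^\star(x)\,b_{h(n)}$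 if $n\in D$. (Being simple over $\hat{e}$ in $X$ presupposes $e_n\in X$ and $e_n^\star\restriction X\in X^\star$.) *)

theory Defs
  imports "HOL-Analysis.Analysis" "HOL-Library.Function_Algebras"
begin

section \<open>Ideals on the natural numbers\<close>

text \<open>The power set itself, the trivial ideal, is allowed.\<close>

definition nat_ideal :: "nat set set \<Rightarrow> bool" where
  "nat_ideal I \<longleftrightarrow>
     (\<forall>A. finite A \<longrightarrow> A \<in> I) \<and>
     (\<forall>A B. A \<in> I \<longrightarrow> B \<subseteq> A \<longrightarrow> B \<in> I) \<and>
     (\<forall>A B. A \<in> I \<longrightarrow> B \<in> I \<longrightarrow> A \<union> B \<in> I)"

definition P_ideal :: "nat set set \<Rightarrow> bool" where
  "P_ideal I \<longleftrightarrow> nat_ideal I \<and>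
     (\<forall>A :: nat \<Rightarrow> nat set. range A \<subseteq> I \<longrightarrow> (\<exists>B\<in>I. \<forall>n. finite (A n - B)))"

text \<open>Analytic sets are the continuous images of the Baire space, together with the empty set.
  The function types carry the product topology of the discrete spaces \<open>nat\<close> and \<open>bool\<close>;
  a set of naturals is identified with its characteristic function.\<close>

definition analytic_set :: "'a::topological_space set \<Rightarrow> bool" where
  "analytic_set S \<longleftrightarrow>
     S = {} \<or> (\<exists>f :: (nat \<Rightarrow> nat) \<Rightarrow> 'a. continuous_on UNIV f \<and> range f = S)"

definition analytic_family :: "nat set set \<Rightarrow> bool" where
  "analytic_family I \<longleftrightarrow> analytic_set ((\<lambda>A n. n \<in> A) ` I)"

section \<open>Submeasures\<close>

definition submeasure :: "(nat set \<Rightarrow> ennreal) \<Rightarrow> bool" where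
  "submeasure \<phi> \<longleftrightarrow> \<phi> {} = 0 \<and> (\<forall>n. \<phi> {n} < \<infinity>) \<and>
     (\<forall>A B. \<phi> A \<le> \<phi> (A \<union> B) \<and> \<phi> (A \<union> B) \<le> \<phi> A + \<phi> B)"

definition lsc :: "(nat set \<Rightarrow> ennreal) \<Rightarrow> bool" where
  "lsc \<phi> \<longleftrightarrow> (\<forall>A. (\<lambda>n. \<phi> (A \<inter> {..<n})) \<longlonglongrightarrow> \<phi> A)"

definition Exh :: "(nat set \<Rightarrow> ennreal) \<Rightarrow> nat set set" where
  "Exh \<phi> = {A. (\<lambda>n. \<phi> (A - {..<n})) \<longlonglongrightarrow> 0}"

definition nonpathological :: "(nat set \<Rightarrow> ennreal) \<Rightarrow> bool" where
  "nonpathological \<phi> \<longleftrightarrow>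
     (\<forall>A. \<phi> A = (SUP \<mu> \<in> {\<mu> :: nat measure. sets \<mu> = UNIV \<and>
                     finite {n. emeasure \<mu> {n} \<noteq> 0} \<and> (\<forall>B. emeasure \<mu> B \<le> \<phi> B)}.
                   emeasure \<mu> A))"

definition nonpathological_analytic_P_ideal :: "nat set set \<Rightarrow> bool" where
  "nonpathological_analytic_P_ideal I \<longleftrightarrow>
     P_ideal I \<and> analytic_family I \<and>
     (\<exists>\<phi>. submeasure \<phi> \<and> lsc \<phi> \<and> nonpathological \<phi> \<and> I = Exh \<phi>)"

section \<open>Banach spaces of real sequences\<close>

text \<open>A Banach space inside the real sequences is a carrier \<open>X\<close> with a norm \<open>N\<close>.
  All notions below depend only on the restriction of \<open>N\<close>, and of the functionals, to \<open>X\<close>.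
  Addition and subtraction of sequences are the pointwise operations.\<close>

type_synonym rseq = "nat \<Rightarrow> real"

definition seq_scale :: "real \<Rightarrow> rseq \<Rightarrow> rseq" where
  "seq_scale c x = (\<lambda>i. c * x i)"

interpretation seq: vector_space seq_scale
  by unfold_locales (auto simp: seq_scale_def fun_eq_iff algebra_simps)

definition norm_on :: "rseq set \<Rightarrow> (rseq \<Rightarrow> real) \<Rightarrow> bool" where
  "norm_on X N \<longleftrightarrow>
     (\<forall>x\<in>X. 0 \<le> N x \<and> (N x = 0 \<longleftrightarrow> x = 0)) \<and>
     (\<forall>c. \<forall>x\<in>X. N (seq_scale c x) = \<bar>c\<bar> * N x) \<and>
     (\<forall>x\<in>X. \<forall>y\<in>X. N (x + y) \<le> N x + N y)"

text \<open>The locale \<open>Metric_space\<close> demands nonnegativity and symmetry also off the carrier,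
  hence the value \<open>0\<close> there.\<close>

definition norm_dist :: "rseq set \<Rightarrow> (rseq \<Rightarrow> real) \<Rightarrow> rseq \<Rightarrow> rseq \<Rightarrow> real" where
  "norm_dist X N x y = (if x \<in> X \<and> y \<in> X then N (x - y) else 0)"

lemma Metric_space_norm_dist:
  assumes X: "seq.subspace X" and N: "norm_on X N"
  shows "Metric_space X (norm_dist X N)"
proof
  have diff: "x - y \<in> X" if "x \<in> X" "y \<in> X" for x y
    using X that by (rule seq.subspace_diff)
  have nonneg: "0 \<le> N x" and zero: "N x = 0 \<longleftrightarrow> x = 0" if "x \<in> X" for x
    using N that unfolding norm_on_def by blast+
  have scale: "N (seq_scale c x) = \<bar>c\<bar> * N x" if "x \<in> X" for c x
    using N that unfolding norm_on_def by blast
  have add: "N (x + y) \<le> N x + N y" if "x \<in> X" "y \<in> X" for x y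
    using N that unfolding norm_on_def by blast
  have comm: "N (y - x) = N (x - y)" if "x \<in> X" "y \<in> X" for x y
  proof -
    have "seq_scale (-1) (x - y) = y - x"
      by (rule ext) (simp add: seq_scale_def)
    with scale[OF diff[OF that], of "-1"] show ?thesis by simp
  qed
  show "0 \<le> norm_dist X N x y" for x y
    unfolding norm_dist_def by (simp add: nonneg diff)
  show "norm_dist X N x y = norm_dist X N y x" for x y
    unfolding norm_dist_def by (cases "x \<in> X \<and> y \<in> X") (simp_all only: comm if_True if_False simp_thms conj_commute)
  show "norm_dist X N x y = 0 \<longleftrightarrow> x = y" if "x \<in> X" "y \<in> X" for x y
    using that by (simp add: norm_dist_def zero[OF diff[OF that]])
  show "norm_dist X N x z \<le> norm_dist X N x y + norm_dist X N y z"
    if "x \<in> X" "y \<in> X" "z \<in> X" for x y z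
    using add[OF diff[OF that(1,2)] diff[OF that(2,3)]] that
    by (simp add: norm_dist_def)
qed

definition banach_seq_space :: "rseq set \<Rightarrow> (rseq \<Rightarrow> real) \<Rightarrow> bool" where
  "banach_seq_space X N \<longleftrightarrow>
     seq.subspace X \<and> norm_on X N \<and> Metric_space.mcomplete X (norm_dist X N)"

definition dual_on :: "rseq set \<Rightarrow> (rseq \<Rightarrow> real) \<Rightarrow> (rseq \<Rightarrow> real) set" where
  "dual_on X N = {f.
     (\<forall>x\<in>X. \<forall>y\<in>X. f (x + y) = f x + f y) \<and>
     (\<forall>c. \<forall>x\<in>X. f (seq_scale c x) = c * f x) \<and>
     continuous_map (Metric_space.mtopology X (norm_dist X N)) euclideanreal f}"

section \<open>Biorthogonal systems and the critical ideal\<close>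

type_synonym system = "nat \<Rightarrow> rseq \<times> (rseq \<Rightarrow> real)"

definition biorthogonal :: "system \<Rightarrow> bool" where
  "biorthogonal a \<longleftrightarrow> (\<forall>n m. snd (a n) (fst (a m)) = (if n = m then 1 else 0))"

definition partial_sum :: "system \<Rightarrow> nat \<Rightarrow> rseq \<Rightarrow> rseq" where
  "partial_sum a n x = (\<Sum>i=0..n. seq_scale (snd (a i) x) (fst (a i)))"

definition ideal_schauder_basis ::
    "nat set set \<Rightarrow> rseq set \<Rightarrow> (rseq \<Rightarrow> real) \<Rightarrow> system \<Rightarrow> bool" where
  "ideal_schauder_basis I X N a \<longleftrightarrow>
     (\<forall>x\<in>X. \<forall>\<epsilon>>0. {n. N (x - partial_sum a n x) \<ge> \<epsilon>} \<in> I)"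

definition critical_ideal :: "rseq set \<Rightarrow> (rseq \<Rightarrow> real) \<Rightarrow> system \<Rightarrow> nat set set" where
  "critical_ideal X N a =
     (THE C. nat_ideal C \<and> (\<forall>I. nat_ideal I \<longrightarrow> (ideal_schauder_basis I X N a \<longleftrightarrow> C \<subseteq> I)))"

lemma critical_ideal_ex1:
  "\<exists>!C. nat_ideal C \<and> (\<forall>I. nat_ideal I \<longrightarrow> (ideal_schauder_basis I X N a \<longleftrightarrow> C \<subseteq> I))"
proof (rule ex_ex1I)
  let ?C = "\<Inter>{I. nat_ideal I \<and> ideal_schauder_basis I X N a}"
  have id: "nat_ideal ?C"
    unfolding nat_ideal_def[of ?C]
  proof (intro conjI allI impI)
    fix A :: "nat set" assume "finite A"
    then show "A \<in> ?C" by (simp add: nat_ideal_def)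
  next
    fix A B assume A: "A \<in> ?C" and "B \<subseteq> A"
    show "B \<in> ?C"
    proof (rule InterI)
      fix J assume J: "J \<in> {I. nat_ideal I \<and> ideal_schauder_basis I X N a}"
      with A have "A \<in> J" by (rule InterD)
      with J \<open>B \<subseteq> A\<close> show "B \<in> J" by (auto simp: nat_ideal_def)
    qed
  next
    fix A B assume A: "A \<in> ?C" and B: "B \<in> ?C"
    show "A \<union> B \<in> ?C"
    proof (rule InterI)
      fix J assume J: "J \<in> {I. nat_ideal I \<and> ideal_schauder_basis I X N a}"
      have "A \<in> J" "B \<in> J" using A B J by (blast dest: InterD)+
      then show "A \<union> B \<in> J" using J by (auto simp: nat_ideal_def)
    qed
  qed
  have sch: "ideal_schauder_basis ?C X N a"
    unfolding ideal_schauder_basis_def by simp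
  have "ideal_schauder_basis I X N a \<longleftrightarrow> ?C \<subseteq> I" if "nat_ideal I" for I
  proof
    assume "ideal_schauder_basis I X N a"
    with that show "?C \<subseteq> I" by (intro Inter_lower) simp
  next
    assume "?C \<subseteq> I"
    with sch show "ideal_schauder_basis I X N a"
      unfolding ideal_schauder_basis_def by (meson subsetD)
  qed
  with id show "\<exists>C. nat_ideal C \<and>
      (\<forall>I. nat_ideal I \<longrightarrow> (ideal_schauder_basis I X N a \<longleftrightarrow> C \<subseteq> I))"
    by (intro exI[of _ ?C] conjI allI impI)
next
  fix C D
  assume "nat_ideal C \<and> (\<forall>I. nat_ideal I \<longrightarrow> (ideal_schauder_basis I X N a \<longleftrightarrow> C \<subseteq> I))"
    and "nat_ideal D \<and> (\<forall>I. nat_ideal I \<longrightarrow> (ideal_schauder_basis I X N a \<longleftrightarrow> D \<subseteq> I))"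
  then show "C = D" by (metis order_refl subset_antisym)
qed

lemma nat_ideal_critical_ideal: "nat_ideal (critical_ideal X N a)"
  using theI'[OF critical_ideal_ex1[of X N a]] unfolding critical_ideal_def by (rule conjunct1)

lemma ideal_schauder_basis_iff:
  "nat_ideal I \<Longrightarrow> ideal_schauder_basis I X N a \<longleftrightarrow> critical_ideal X N a \<subseteq> I"
  using theI'[OF critical_ideal_ex1[of X N a], THEN conjunct2, rule_format, of I]
  unfolding critical_ideal_def .

text \<open>Intervals of naturals are the order-convex sets.\<close>

definition nat_interval :: "nat set \<Rightarrow> bool" where
  "nat_interval A \<longleftrightarrow> (\<forall>i\<in>A. \<forall>j\<in>A. {i..j} \<subseteq> A)"

definition simple_over ::
    "rseq set \<Rightarrow> (rseq \<Rightarrow> real) \<Rightarrow> system \<Rightarrow> system \<Rightarrow> bool" where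
  "simple_over X N a u \<longleftrightarrow>
     range a \<subseteq> X \<times> dual_on X N \<and> biorthogonal a \<and>
     range u \<subseteq> X \<times> dual_on X N \<and> biorthogonal u \<and>
     (\<exists>(D :: nat set) (h :: nat \<Rightarrow> nat) (b :: nat \<Rightarrow> rseq).
        (\<forall>k. nat_interval {n \<in> D. h n = k}) \<and>
        (\<forall>k \<in> h ` D. b k \<in> X - {0}) \<and>
        (\<forall>x\<in>X. \<forall>n.
           partial_sum u n x - partial_sum a n x =
             (if n \<in> D then seq_scale (snd (u (h n)) x) (b (h n)) else 0)))"

definition unit_system :: system where
  "unit_system n = ((\<lambda>i. if i = n then 1 else 0), (\<lambda>x. x n))"

end

(* Let P x be the supremum, over the measures mu dominated by phi, of the integral of |x (Suc n)|
   with respect to mu, made into a norm by adding the weights 2^-n at the single points n, and let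
   X consist of the sequences whose tails tend to 0 in P.  Since phi is non-pathological,
   P (indicator (Suc ` A)) is phi A up to an error that vanishes along tails, so Exh phi consists
   of the sets {n. |x (Suc n)| >= e} with x in X, e > 0.

   With w 0 = 1 and w n = P (w 0, ..., w (n-1), 0, 0, ...), the vectors a n = (w 0, ..., w n, 0, 0, ...)
   and functionals x n / w n - x (n+1) / w (n+1) telescope: their n-th partial sum at x differs from
   the truncation of x by x (n+1) times a vector of norm 1.  As the tails of x vanish in the limit,
   the n-th remainder is large exactly when |x (n+1)| is. *)
theory Submission
  imports Defs
begin

section \<open>Restriction of sequences to sets of indices\<close>

definition restr :: "nat set \<Rightarrow> rseq \<Rightarrow> rseq" where
  "restr A x = (\<lambda>i. if i \<in> A then x i else 0)"

abbreviation unit_seq :: "nat \<Rightarrow> rseq" where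
  "unit_seq n \<equiv> (\<lambda>i. if i = n then 1 else 0)"

lemma seq_scale_apply [simp]: "seq_scale c x i = c * x i"
  by (simp add: seq_scale_def)

lemma restr_apply: "restr A x i = (if i \<in> A then x i else 0)"
  by (simp add: restr_def)

lemma restr_add: "restr A (x + y) = restr A x + restr A y"
  and restr_diff_head: "x - restr {..<n} x = restr {n..} x"
  and restr_scale: "restr A (seq_scale c x) = seq_scale c (restr A x)"
  and restr_split: "x = restr {..<n} x + restr {n..} x"
  and restr_lessThan_Suc: "restr {..<Suc n} x = restr {..<n} x + seq_scale (x n) (unit_seq n)"
  by (auto simp: restr_apply fun_eq_iff less_Suc_eq)

section \<open>Solid norms and biorthogonal systems of initial segments\<close>

text \<open>Extended values allow \<open>P\<close> to live on all sequences, so that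
  \<open>X\<close> can be cut out by a condition on \<open>P\<close>. \<open>Fatou\<close> plays the
  part of lower semicontinuity: a bound on all initial segments carries over to the whole sequence,
  which is what completeness needs.\<close>

locale solid_norm =
  fixes P :: "rseq \<Rightarrow> ennreal"
  assumes mono: "(\<And>i. \<bar>x i\<bar> \<le> \<bar>y i\<bar>) \<Longrightarrow> P x \<le> P y"
    and add: "P (x + y) \<le> P x + P y"
    and scale: "P (seq_scale c x) = ennreal \<bar>c\<bar> * P x"
    and unit_pos: "P (unit_seq n) > 0"
    and unit_finite: "P (unit_seq n) < top"
    and Fatou: "(\<And>n. P (restr {..<n} x) \<le> C) \<Longrightarrow> P x \<le> C"
begin

text \<open>Since \<open>enn2real\<close> sends \<open>top\<close> to \<open>0\<close>, this is
  meaningful only where \<open>P\<close> is finite, in particular on \<open>X\<close>.\<close>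

definition N :: "rseq \<Rightarrow> real" where
  "N x = enn2real (P x)"

text \<open>The analogue of \<open>Exh\<close> for sequences: exactly those approximated in
  \<open>P\<close> by their own initial segments.\<close>

definition X :: "rseq set" where
  "X = {x. (\<lambda>n. P (restr {n..} x)) \<longlonglongrightarrow> 0}"

lemma zero: "P 0 = 0"
  using scale[of 0 0] by (simp add: seq_scale_def zero_fun_def)

lemma restr_le: "P (restr A x) \<le> P x"
  by (rule mono) (simp add: restr_apply)

text \<open>The triangle inequality, one coordinate at a time. It makes initial segments finite in
  \<open>P\<close> and turns coordinatewise convergence into convergence of segments of fixed
  length.\<close>

lemma head_le: "P (restr {..<n} x) \<le> (\<Sum>i<n. ennreal \<bar>x i\<bar> * P (unit_seq i))"
proof (induction n)
  case 0
  have "restr {..<0} x = 0" by (simp add: restr_def fun_eq_iff)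
  then have "P (restr {..<0} x) = 0" by (simp only: zero)
  then show ?case by simp
next
  case (Suc n)
  show ?case
    unfolding restr_lessThan_Suc
    by (rule order.trans[OF add]) (simp add: scale add_mono Suc.IH)
qed

lemma head_finite: "P (restr {..<n} x) < top"
  by (rule order.strict_trans1[OF head_le])
    (simp add: ennreal_mult_less_top unit_finite)

lemma X_finite: assumes "x \<in> X" shows "P x < top"
proof -
  have "eventually (\<lambda>n. P (restr {n..} x) < 1) sequentially"
    using assms unfolding X_def by (auto elim!: order_tendstoD)
  then obtain n where "P (restr {n..} x) < 1"
    by (auto dest: eventually_happens)
  then have "P (restr {..<n} x) + P (restr {n..} x) < top"
    using head_finite[of n x] order.strict_trans[of _ 1 "top :: ennreal"] by simp
  with add[of "restr {..<n} x" "restr {n..} x"] show ?thesis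
    by (simp add: order.strict_trans1 flip: restr_split)
qed

lemma P_eq: "x \<in> X \<Longrightarrow> P x = ennreal (N x)"
  unfolding N_def using X_finite by simp

lemma finite_support_in_X: assumes "\<And>i. i \<ge> n \<Longrightarrow> x i = 0" shows "x \<in> X"
proof -
  have "restr {m..} x = 0" if "m \<ge> n" for m
    using that assms by (auto simp: restr_def fun_eq_iff)
  then show ?thesis
    unfolding X_def using zero
    by (auto intro!: tendsto_eventually eventually_sequentiallyI[of n])
qed

lemma X_add: assumes "x \<in> X" "y \<in> X" shows "x + y \<in> X"
proof -
  have "(\<lambda>n. P (restr {n..} x) + P (restr {n..} y)) \<longlonglongrightarrow> 0"
    using tendsto_add[of "\<lambda>n. P (restr {n..} x)" 0 sequentially "\<lambda>n. P (restr {n..} y)" 0]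
      assms unfolding X_def by simp
  then show ?thesis
    unfolding X_def mem_Collect_eq
    by (rule tendsto_sandwich[rotated 3, OF _ _ _ tendsto_const]) (auto simp: restr_add add)
qed

lemma X_scale: assumes "x \<in> X" shows "seq_scale c x \<in> X"
proof -
  have "(\<lambda>n. ennreal \<bar>c\<bar> * P (restr {n..} x)) \<longlonglongrightarrow> ennreal \<bar>c\<bar> * 0"
    using assms unfolding X_def by (intro ennreal_tendsto_cmult) auto
  then show ?thesis
    unfolding X_def by (simp add: restr_scale scale)
qed

lemma X_subspace: "seq.subspace X"
  unfolding seq.subspace_def using X_add X_scale finite_support_in_X[of 0 0] by auto

lemmas X_diff = seq.subspace_diff[OF X_subspace]

lemma N_nonneg: "0 \<le> N x"
  by (simp add: N_def)

lemma N_mono: "\<lbrakk>y \<in> X; \<And>i. \<bar>x i\<bar> \<le> \<bar>y i\<bar>\<rbrakk> \<Longrightarrow> N x \<le> N y"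
  unfolding N_def by (intro enn2real_mono mono X_finite)

lemma N_add: assumes "x \<in> X" "y \<in> X" shows "N (x + y) \<le> N x + N y"
proof -
  have "ennreal (N (x + y)) \<le> ennreal (N x + N y)"
    using add[of x y] assms by (simp add: P_eq X_add N_nonneg)
  then show ?thesis by (rule ennreal_le_iff[THEN iffD1, rotated]) (simp add: N_nonneg)
qed

lemma N_scale: "N (seq_scale c x) = \<bar>c\<bar> * N x"
  by (simp add: N_def scale enn2real_mult)

lemma N_unit_pos: "N (unit_seq n) > 0"
  unfolding N_def using unit_pos unit_finite by (simp add: enn2real_positive_iff)

text \<open>By solidity, a single coordinate of \<open>x\<close>, kept in place, is no larger in
  norm than \<open>x\<close>. Hence definiteness of \<open>N\<close> and continuity of the
  coordinates.\<close>

lemma coord_le: assumes "x \<in> X" shows "\<bar>x n\<bar> \<le> N x / N (unit_seq n)"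
proof -
  have "N (seq_scale (x n) (unit_seq n)) \<le> N x"
    by (rule N_mono) (auto simp: assms)
  then show ?thesis using N_unit_pos[of n] by (simp add: N_scale field_simps)
qed

lemma norm_on: "norm_on X N"
proof -
  have "x = 0" if "x \<in> X" "N x = 0" for x
    using coord_le[OF that(1)] that(2) by (auto simp: fun_eq_iff)
  moreover have "N 0 = 0" by (simp add: N_def zero)
  ultimately show ?thesis
    unfolding norm_on_def by (auto simp: N_nonneg N_scale N_add)
qed

section \<open>The metric of the norm and its completeness\<close>

sublocale met: Metric_space X "norm_dist X N"
  by (rule Metric_space_norm_dist[OF X_subspace norm_on])

text \<open>One good approximant \<open>s k\<close> has small tails, and cutting
  \<open>x - s k\<close> down to a tail does not increase \<open>P\<close>. The hypothesis uses
  \<open>P\<close>, as \<open>N\<close> says nothing about an \<open>x\<close> not yet known to lie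
  in \<open>X\<close>.\<close>

lemma limit_in_X:
  assumes s: "\<And>k. s k \<in> X" and lim: "(\<lambda>k. P (x - s k)) \<longlonglongrightarrow> 0"
  shows "x \<in> X"
proof -
  have "\<exists>n0. \<forall>n\<ge>n0. P (restr {n..} x) < e" if "e > 0" for e
  proof -
    \<comment> \<open>Half of \<open>e\<close>, except that \<open>e\<close> may be
      \<open>top\<close>, where \<open>1\<close> serves.\<close>
    obtain d where d: "d > 0" "d + d \<le> e"
    proof (cases e)
      case (real r)
      then show ?thesis using that that[of "ennreal (r/2)"] \<open>e > 0\<close>
        by (auto simp flip: ennreal_plus)
    next
      case top
      then show ?thesis using that[of 1] by auto
    qed
    obtain k where k: "P (x - s k) < d"
      using order_tendstoD(2)[OF lim d(1)] by (auto dest: eventually_happens)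
    have "eventually (\<lambda>n. P (restr {n..} (s k)) < d) sequentially"
      using s[of k] d(1) unfolding X_def by (auto elim!: order_tendstoD)
    then obtain n0 where n0: "\<And>n. n \<ge> n0 \<Longrightarrow> P (restr {n..} (s k)) < d"
      by (auto simp: eventually_sequentially)
    have "P (restr {n..} x) < e" if "n \<ge> n0" for n
    proof -
      have "restr {n..} x = restr {n..} (x - s k) + restr {n..} (s k)"
        by (auto simp: restr_apply fun_eq_iff)
      then have "P (restr {n..} x) \<le> P (restr {n..} (x - s k)) + P (restr {n..} (s k))"
        by (metis add)
      also have "\<dots> \<le> P (x - s k) + P (restr {n..} (s k))"
        by (intro add_mono restr_le order.refl)
      also have "\<dots> < d + d" by (intro add_strict_mono k n0 that)
      finally show ?thesis using d(2) by simp
    qed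
    then show ?thesis by blast
  qed
  then show ?thesis
    unfolding X_def by (auto intro!: order_tendstoI simp: eventually_sequentially)
qed

text \<open>The coordinates are Cauchy by \<open>coord_le\<close>; their limits form
  \<open>x\<close>. \<open>Fatou\<close> yields convergence to \<open>x\<close> in \<open>P\<close>,
  and \<open>limit_in_X\<close> places \<open>x\<close> in \<open>X\<close>.\<close>

lemma mcomplete: "met.mcomplete"
  unfolding met.mcomplete_def
proof (intro allI impI)
  fix s assume "met.MCauchy s"
  then have s: "\<And>k. s k \<in> X"
    and Cau: "\<And>e. e > 0 \<Longrightarrow> \<exists>K. \<forall>k l. K \<le> k \<longrightarrow> K \<le> l \<longrightarrow> N (s k - s l) < e"
    unfolding met.MCauchy_def by (auto simp: norm_dist_def image_subset_iff)
  have "Cauchy (\<lambda>k. s k i)" for i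
  proof (rule CauchyI)
    fix e :: real assume "e > 0"
    with Cau[of "e * N (unit_seq i)"] obtain K
      where K: "\<And>k l. K \<le> k \<Longrightarrow> K \<le> l \<Longrightarrow> N (s k - s l) < e * N (unit_seq i)"
      using N_unit_pos[of i] by auto
    have "norm (s k i - s l i) < e" if "K \<le> k" "K \<le> l" for k l
      using coord_le[OF X_diff[OF s s], of k l i] K[OF that] N_unit_pos[of i]
      by (simp add: pos_le_divide_eq) (meson le_less_trans mult_less_cancel_right_pos)
    then show "\<exists>M. \<forall>m\<ge>M. \<forall>n\<ge>M. norm (s m i - s n i) < e" by blast
  qed
  then have "\<exists>l. (\<lambda>k. s k i) \<longlonglongrightarrow> l" for i
    by (simp add: Cauchy_convergent_iff convergent_def)
  then obtain x where x: "\<And>i. (\<lambda>k. s k i) \<longlonglongrightarrow> x i" by metis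
  have unif: "\<exists>K. \<forall>k\<ge>K. P (x - s k) \<le> ennreal e" if "e > 0" for e
  proof -
    obtain K where K: "\<And>k l. K \<le> k \<Longrightarrow> K \<le> l \<Longrightarrow> N (s k - s l) < e"
      using Cau[OF \<open>e > 0\<close>] by blast
    have "P (x - s k) \<le> ennreal e" if "k \<ge> K" for k
    proof (rule Fatou)
      fix n
      \<comment> \<open>The segment of \<open>x - s k\<close> is compared through a later
        \<open>s l\<close>. With \<open>n\<close> fixed, the finite sum bounds the segment of
        \<open>x - s l\<close> and vanishes as \<open>l\<close> grows, while
        \<open>s l - s k\<close> costs at most \<open>e\<close>, whatever \<open>n\<close>
        is.\<close>
      let ?g = "\<lambda>l. (\<Sum>i<n. P (unit_seq i) * ennreal \<bar>x i - s l i\<bar>) + ennreal e"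
      have "?g \<longlonglongrightarrow> (\<Sum>i<n. P (unit_seq i) * ennreal \<bar>x i - x i\<bar>) + ennreal e"
        using unit_finite
        by (intro tendsto_intros ennreal_tendsto_cmult x) auto
      then have "?g \<longlonglongrightarrow> ennreal e" by simp
      moreover have "P (restr {..<n} (x - s k)) \<le> ?g l" if "l \<ge> K" for l
      proof -
        have "restr {..<n} (x - s k) = restr {..<n} (x - s l) + restr {..<n} (s l - s k)"
          by (auto simp: restr_apply fun_eq_iff)
        then have "P (restr {..<n} (x - s k))
            \<le> P (restr {..<n} (x - s l)) + P (restr {..<n} (s l - s k))"
          by (metis add)
        also have "P (restr {..<n} (x - s l)) \<le> (\<Sum>i<n. P (unit_seq i) * ennreal \<bar>x i - s l i\<bar>)"
          using head_le[of n "x - s l"] by (simp add: mult.commute)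
        also have "P (restr {..<n} (s l - s k)) \<le> ennreal e"
          using K[OF that \<open>k \<ge> K\<close>]
          by (intro order.trans[OF restr_le]) (simp add: P_eq X_diff s ennreal_leI)
        finally show ?thesis by (simp add: add_mono)
      qed
      ultimately show "P (restr {..<n} (x - s k)) \<le> ennreal e"
        by (intro Lim_bounded2[where N = K]) auto
    qed
    then show ?thesis by blast
  qed
  have lim: "(\<lambda>k. P (x - s k)) \<longlonglongrightarrow> 0"
  proof (rule order_tendstoI)
    fix a :: ennreal assume "0 < a"
    then obtain e where e: "e > 0" "ennreal e < a"
    proof -
      obtain z where z: "0 < z" "z < a" using dense[OF \<open>0 < a\<close>] by blast
      then show ?thesis using that by (cases z) auto
    qed
    then show "eventually (\<lambda>k. P (x - s k) < a) sequentially"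
      using unif[OF e(1)] by (auto simp: eventually_sequentially intro: order.strict_trans1)
  qed auto
  have xX: "x \<in> X" by (rule limit_in_X[OF s lim])
  have "(\<lambda>k. N (x - s k)) \<longlonglongrightarrow> 0"
    using lim xX s by (simp add: P_eq X_diff N_nonneg tendsto_ennreal_iff[of _ _ 0, simplified])
  then have "(\<lambda>k. norm_dist X N (s k) x) \<longlonglongrightarrow> 0"
    using xX s by (subst met.commute) (simp add: norm_dist_def)
  then show "\<exists>x. limitin met.mtopology s x sequentially"
    using xX s by (auto simp: met.limitin_metric_dist_null)
qed

lemma banach: "banach_seq_space X N"
  unfolding banach_seq_space_def using X_subspace norm_on mcomplete by blast

section \<open>Continuous functionals and vectors of finite support\<close>

lemma bounded_in_dual:
  assumes "\<And>x y. x \<in> X \<Longrightarrow> y \<in> X \<Longrightarrow> f (x + y) = f x + f y"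
    and "\<And>c x. x \<in> X \<Longrightarrow> f (seq_scale c x) = c * f x"
    and bd: "\<And>x. x \<in> X \<Longrightarrow> \<bar>f x\<bar> \<le> C * N x"
  shows "f \<in> dual_on X N"
proof -
  have "continuous_map met.mtopology Met_TC.mtopology f"
    unfolding met.metric_continuous_map[OF Met_TC.Metric_space_axioms]
  proof (intro conjI ballI allI impI subset_UNIV)
    fix x e :: real and a assume a: "a \<in> X" and "e > 0"
    \<comment> \<open>The sign of \<open>C\<close> is not assumed; the absolute value and the added
      \<open>1\<close> make the divisor positive.\<close>
    let ?d = "e / (\<bar>C\<bar> + 1)"
    have "dist (f a) (f y) < e" if y: "y \<in> X" "norm_dist X N a y < ?d" for y
    proof -
      have "f a = f (a - y) + f y" using assms(1)[OF X_diff[OF a y(1)] y(1)] by simp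
      then have "dist (f a) (f y) \<le> C * N (a - y)"
        using bd[OF X_diff[OF a y(1)]] by (simp add: dist_real_def)
      also have "\<dots> \<le> (\<bar>C\<bar> + 1) * N (a - y)"
        by (intro mult_right_mono N_nonneg) auto
      also have "\<dots> < e" using y a by (simp add: norm_dist_def field_simps)
      finally show ?thesis .
    qed
    moreover have "?d > 0" using \<open>e > 0\<close> by simp
    ultimately show "\<exists>d>0. \<forall>y. y \<in> X \<and> norm_dist X N a y < d \<longrightarrow> dist (f a) (f y) < e"
      by blast
  qed
  then show ?thesis using assms(1,2) by (simp add: dual_on_def)
qed

lemma unit_seq_in_X: "unit_seq n \<in> X"
  by (rule finite_support_in_X[of "Suc n"]) auto

lemma head_in_X: "restr {..<n} x \<in> X"
  by (rule finite_support_in_X[of n]) (auto simp: restr_apply)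

lemma tail_in_X: "x \<in> X \<Longrightarrow> restr {n..} x \<in> X"
  using X_diff[OF _ head_in_X, of x n x]
  by (simp add: restr_diff_head)

lemma unit_system_in: "range unit_system \<subseteq> X \<times> dual_on X N"
proof -
  have "(\<lambda>x. x n) \<in> dual_on X N" for n
    by (rule bounded_in_dual[where C = "1 / N (unit_seq n)"]) (use coord_le in auto)
  then show ?thesis by (auto simp: unit_system_def unit_seq_in_X)
qed

text \<open>The vector \<open>restr {..<k} weight\<close> divided by its norm has to equal \<open>bump k\<close>, but biorthogonality
  forces the divisor \<open>weight k\<close>; hence the recursion.\<close>

function weight :: "nat \<Rightarrow> real" where
  "weight n = (if n = 0 then 1 else N (\<lambda>i. if i < n then weight i else 0))"
  by auto
termination by (relation "Wellfounded.measure id") auto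

declare weight.simps [simp del]

lemma weight_0: "weight 0 = 1"
  by (simp add: weight.simps)

lemma weight_Suc: "weight (Suc n) = N (restr {..<Suc n} weight)"
  by (subst weight.simps) (simp add: restr_def)

lemma weight_pos: "weight n > 0"
proof (cases n)
  case (Suc m)
  \<comment> \<open>Every nonempty segment of \<open>weight\<close> contains the entry
    \<open>1\<close> at \<open>0\<close>.\<close>
  have "N (unit_seq 0) \<le> N (restr {..<Suc m} weight)"
    by (rule N_mono) (auto simp: head_in_X restr_apply weight_0)
  with N_unit_pos[of 0] Suc show ?thesis by (simp add: weight_Suc)
qed (simp add: weight_0)

section \<open>The telescoping system and its partial sums\<close>

definition bump :: "nat \<Rightarrow> rseq" where
  "bump k = seq_scale (1 / weight k) (restr {..<k} weight)"

lemma bump_in_X: "bump k \<in> X"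
  unfolding bump_def by (intro X_scale head_in_X)

text \<open>The recursion makes the divisor equal to the norm of the segment. \<open>bump 0\<close>
  is the zero sequence, hence the successor.\<close>

lemma N_bump: "N (bump (Suc k)) = 1"
  using weight_pos[of "Suc k"] by (simp add: bump_def N_scale weight_Suc[symmetric])

definition basis :: system where
  "basis n = (restr {..<Suc n} weight, \<lambda>x. x n / weight n - x (Suc n) / weight (Suc n))"

text \<open>Divided by \<open>weight\<close>, the \<open>m\<close>-th vector is the indicator of
  \<open>{..m}\<close>, and a difference of consecutive entries of that indicator is
  \<open>1\<close> at \<open>m\<close> and \<open>0\<close> elsewhere.\<close>

lemma biorthogonal_basis: "biorthogonal basis"
  using weight_pos[THEN less_imp_neq]
  by (auto simp: biorthogonal_def basis_def restr_apply not_less dest: sym)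

lemma basis_in: "range basis \<subseteq> X \<times> dual_on X N"
proof -
  have "(\<lambda>x. x n / weight n - x (Suc n) / weight (Suc n)) \<in> dual_on X N" (is "?f \<in> _") for n
  proof (rule bounded_in_dual)
    fix x assume x: "x \<in> X"
    have *: "\<bar>x i / weight i\<bar> \<le> 1 / (N (unit_seq i) * weight i) * N x" for i
      using coord_le[OF x, of i] weight_pos[of i] N_unit_pos[of i]
      by (simp add: abs_div field_simps)
    show "\<bar>?f x\<bar> \<le> (1 / (N (unit_seq n) * weight n)
        + 1 / (N (unit_seq (Suc n)) * weight (Suc n))) * N x"
      using *[of n] *[of "Suc n"] unfolding distrib_right by linarith
  qed (auto simp: field_simps diff_divide_distrib add_divide_distrib)
  then show ?thesis by (auto simp: basis_def head_in_X)
qed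

lemma partial_sum_Suc:
  "partial_sum a (Suc n) x = partial_sum a n x + seq_scale (snd (a (Suc n)) x) (fst (a (Suc n)))"
  by (simp add: partial_sum_def)

lemma partial_sum_unit: "partial_sum unit_system n x = restr {..<Suc n} x"
proof (induction n)
  case (Suc n)
  then show ?case
    unfolding partial_sum_Suc Suc.IH by (auto simp: unit_system_def restr_apply fun_eq_iff less_Suc_eq)
qed (auto simp: partial_sum_def unit_system_def restr_apply fun_eq_iff)

text \<open>Coordinate \<open>j \<le> n\<close> collects the functionals from \<open>j\<close> to
  \<open>n\<close>, which telescope to \<open>x j / weight j - x (Suc n) / weight (Suc n)\<close>,
  times \<open>weight j\<close>.\<close>

lemma partial_sum_basis:
  "partial_sum basis n x = restr {..<Suc n} x - seq_scale (x (Suc n)) (bump (Suc n))"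
proof (induction n)
  case 0
  show ?case
    using weight_pos[of 0] weight_pos[of 1]
    by (auto simp: partial_sum_def basis_def bump_def restr_apply fun_eq_iff field_simps)
next
  case (Suc n)
  show ?case
    unfolding partial_sum_Suc Suc
    using weight_pos[of "Suc n"] weight_pos[of "Suc (Suc n)"]
    by (auto simp: basis_def bump_def restr_apply fun_eq_iff field_simps less_Suc_eq)
qed

lemma simple_over_basis: "simple_over X N basis unit_system"
  unfolding simple_over_def
\<comment> \<open>With \<open>h = Suc\<close> every fibre is empty or a single point, and the
  vanishing \<open>bump 0\<close> lies outside the range of \<open>h\<close>.\<close>
proof (intro conjI exI[of _ UNIV] exI[of _ Suc] exI[of _ bump] ballI allI)
  show "biorthogonal unit_system"
    by (auto simp: biorthogonal_def unit_system_def)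
  show "nat_interval {n \<in> UNIV. Suc n = k}" for k
    by (auto simp: nat_interval_def)
  show "bump k \<in> X - {0}" if "k \<in> range Suc" for k
  proof -
    from that obtain j where k: "k = Suc j" by auto
    have "bump k \<noteq> 0" using N_bump[of j] by (auto simp: k N_def zero)
    then show ?thesis using bump_in_X by simp
  qed
  show "partial_sum unit_system n x - partial_sum basis n x =
    (if n \<in> UNIV then seq_scale (snd (unit_system (Suc n)) x) (bump (Suc n)) else 0)" for x n
    by (simp add: partial_sum_unit partial_sum_basis unit_system_def)
qed (rule basis_in unit_system_in biorthogonal_basis)+

section \<open>The ideals for which the system is a basis\<close>

lemma finite_large_tails:
  assumes "x \<in> X" "e > 0"
  shows "finite {n. N (restr {Suc n..} x) \<ge> e}"
proof -
  have "(\<lambda>n. N (restr {n..} x)) \<longlonglongrightarrow> 0"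
    using assms(1) tail_in_X[OF assms(1)] unfolding X_def
    by (auto simp: N_def intro: tendsto_enn2real[where l = 0, simplified])
  then have "(\<lambda>n. N (restr {Suc n..} x)) \<longlonglongrightarrow> 0" by (rule LIMSEQ_Suc)
  from order_tendstoD(2)[OF this assms(2)]
  show ?thesis by (simp add: cofinite_eq_sequentially[symmetric] eventually_cofinite not_less)
qed

text \<open>The remainder is a tail of \<open>x\<close> plus \<open>x (Suc n)\<close> times a vector
  of norm \<open>1\<close>. Tails are large only finitely often, and every ideal contains the finite
  sets.\<close>

lemma ideal_schauder_basis_basis_iff:
  assumes J: "nat_ideal J"
  shows "ideal_schauder_basis J X N basis \<longleftrightarrow> (\<forall>x\<in>X. \<forall>e>0. {n. \<bar>x (Suc n)\<bar> \<ge> e} \<in> J)"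
proof -
  let ?r = "\<lambda>x n. x - partial_sum basis n x"
  have r: "?r x n = restr {Suc n..} x + seq_scale (x (Suc n)) (bump (Suc n))" for x n
    unfolding partial_sum_basis by (auto simp: restr_apply fun_eq_iff)
  have up: "N (?r x n) \<le> \<bar>x (Suc n)\<bar> + N (restr {Suc n..} x)" if "x \<in> X" for x n
    using N_add[OF tail_in_X[OF that] X_scale[OF bump_in_X], of "Suc n" "x (Suc n)" "Suc n"]
    by (simp add: r N_scale N_bump add.commute)
  have low: "\<bar>x (Suc n)\<bar> \<le> N (?r x n) + N (restr {Suc n..} x)" if "x \<in> X" for x n
  proof -
    have rX: "?r x n \<in> X" unfolding r by (intro X_add tail_in_X X_scale bump_in_X that)
    have eq: "seq_scale (x (Suc n)) (bump (Suc n)) = ?r x n + seq_scale (-1) (restr {Suc n..} x)"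
      unfolding r by (auto simp: fun_eq_iff)
    have "N (seq_scale (x (Suc n)) (bump (Suc n))) \<le> N (?r x n) + N (seq_scale (-1) (restr {Suc n..} x))"
      unfolding eq by (intro N_add rX X_scale tail_in_X that)
    then show ?thesis unfolding N_scale N_bump by simp
  qed
  \<comment> \<open>Serves both directions, with the norm of the remainder and the absolute
    coordinate exchanging the roles of \<open>f\<close> and \<open>g\<close>.\<close>
  have transfer: "{n. f n \<ge> e} \<in> J"
    if x: "x \<in> X" and e: "(e::real) > 0" and g: "{n. g n \<ge> e/2} \<in> J"
      and le: "\<And>n. f n \<le> g n + N (restr {Suc n..} x)" for f g x e
  proof -
    have "{n. f n \<ge> e} \<subseteq> {n. g n \<ge> e/2} \<union> {n. N (restr {Suc n..} x) \<ge> e/2}"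
      using le by (smt (verit) Collect_mono_iff field_sum_of_halves mem_Collect_eq subsetI UnCI)
    moreover have "{n. N (restr {Suc n..} x) \<ge> e/2} \<in> J"
      using finite_large_tails[OF x, of "e/2"] e J by (simp add: nat_ideal_def)
    ultimately show ?thesis using J g unfolding nat_ideal_def by blast
  qed
  show ?thesis
  proof
    assume S: "ideal_schauder_basis J X N basis"
    show "\<forall>x\<in>X. \<forall>e>0. {n. \<bar>x (Suc n)\<bar> \<ge> e} \<in> J"
    proof (intro ballI allI impI)
      fix x and e :: real assume "x \<in> X" "e > 0"
      moreover from this have "{n. N (?r x n) \<ge> e/2} \<in> J"
        using S half_gt_zero unfolding ideal_schauder_basis_def by blast
      ultimately show "{n. \<bar>x (Suc n)\<bar> \<ge> e} \<in> J"
        using low[OF \<open>x \<in> X\<close>] by (rule transfer)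
    qed
  next
    assume S: "\<forall>x\<in>X. \<forall>e>0. {n. \<bar>x (Suc n)\<bar> \<ge> e} \<in> J"
    show "ideal_schauder_basis J X N basis"
      unfolding ideal_schauder_basis_def
    proof (intro ballI allI impI)
      fix x and e :: real assume "x \<in> X" "e > 0"
      moreover from this have "{n. \<bar>x (Suc n)\<bar> \<ge> e/2} \<in> J"
        using S half_gt_zero by blast
      ultimately show "{n. N (?r x n) \<ge> e} \<in> J"
        using up[OF \<open>x \<in> X\<close>] by (rule transfer)
    qed
  qed
qed

end

section \<open>The norm of a non-pathological submeasure\<close>

definition weighted_sum :: "(nat \<Rightarrow> ennreal) \<Rightarrow> rseq \<Rightarrow> ennreal" where
  "weighted_sum w x = (\<Sum>n. w n * ennreal \<bar>x n\<bar>)"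

lemma weighted_sum_unit: "weighted_sum w (unit_seq n) = w n"
proof -
  have "weighted_sum w (unit_seq n) = (\<Sum>i\<in>{n}. w i * ennreal \<bar>unit_seq n i\<bar>)"
    unfolding weighted_sum_def by (rule suminf_finite) auto
  then show ?thesis by simp
qed

lemma weighted_sum_mono: "(\<And>i. \<bar>x i\<bar> \<le> \<bar>y i\<bar>) \<Longrightarrow> weighted_sum w x \<le> weighted_sum w y"
  unfolding weighted_sum_def by (intro suminf_le mult_left_mono ennreal_leI) auto

text \<open>Each weighted l1-seminorm is solid, and suprema preserve the inequalities.
  \<open>Fatou\<close> holds because a partial sum of the series sees only an initial
  segment.\<close>

lemma solid_norm_SUP:
  fixes W :: "(nat \<Rightarrow> ennreal) set"
  assumes pos: "\<And>n. \<exists>w\<in>W. w n > 0" and fin: "\<And>n. (SUP w\<in>W. w n) < top"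
  shows "solid_norm (\<lambda>x. SUP w\<in>W. weighted_sum w x)"
proof
  fix x y :: rseq and c :: real
  show "(SUP w\<in>W. weighted_sum w x) \<le> (SUP w\<in>W. weighted_sum w y)"
    if "\<And>i. \<bar>x i\<bar> \<le> \<bar>y i\<bar>"
    using that by (intro SUP_mono) (auto intro: weighted_sum_mono)
  show "(SUP w\<in>W. weighted_sum w (x + y))
      \<le> (SUP w\<in>W. weighted_sum w x) + (SUP w\<in>W. weighted_sum w y)"
  proof (rule SUP_least)
    fix w assume w: "w \<in> W"
    have "weighted_sum w (x + y) \<le> (\<Sum>n. w n * ennreal \<bar>x n\<bar> + w n * ennreal \<bar>y n\<bar>)"
      unfolding weighted_sum_def
      by (intro suminf_le) (auto intro!: mult_left_mono ennreal_leI simp flip: distrib_left ennreal_plus)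
    also have "\<dots> = weighted_sum w x + weighted_sum w y"
      unfolding weighted_sum_def by (rule suminf_add[symmetric]) auto
    also have "\<dots> \<le> (SUP w\<in>W. weighted_sum w x) + (SUP w\<in>W. weighted_sum w y)"
      using w by (intro add_mono SUP_upper)
    finally show "weighted_sum w (x + y) \<le> \<dots>" .
  qed
  have "weighted_sum w (seq_scale c x) = ennreal \<bar>c\<bar> * weighted_sum w x" for w
    unfolding weighted_sum_def
    by (simp add: abs_mult ennreal_mult mult.left_commute flip: ennreal_suminf_cmult)
  then show "(SUP w\<in>W. weighted_sum w (seq_scale c x)) = ennreal \<bar>c\<bar> * (SUP w\<in>W. weighted_sum w x)"
    by (simp add: SUP_mult_left_ennreal)
  show "(SUP w\<in>W. weighted_sum w (unit_seq n)) > 0" for n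
    using pos[of n] by (auto simp: weighted_sum_unit less_SUP_iff)
  show "(SUP w\<in>W. weighted_sum w (unit_seq n)) < top" for n
    using fin[of n] by (simp add: weighted_sum_unit)
  show "(SUP w\<in>W. weighted_sum w x) \<le> C"
    if C: "\<And>n. (SUP w\<in>W. weighted_sum w (restr {..<n} x)) \<le> C" for C
  proof (rule SUP_least)
    fix w assume w: "w \<in> W"
    show "weighted_sum w x \<le> C"
      unfolding weighted_sum_def
    proof (rule suminf_le_const)
      fix n
      have "(\<Sum>i<n. w i * ennreal \<bar>x i\<bar>) = (\<Sum>i<n. w i * ennreal \<bar>restr {..<n} x i\<bar>)"
        by (simp add: restr_apply)
      also have "\<dots> \<le> weighted_sum w (restr {..<n} x)"
        unfolding weighted_sum_def by (rule sum_le_suminf) auto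
      also have "\<dots> \<le> C" using C[of n] w by (auto simp: SUP_le_iff)
      finally show "(\<Sum>i<n. w i * ennreal \<bar>x i\<bar>) \<le> C" .
    qed auto
  qed
qed

section \<open>Comparison of the submeasure with the norm of indicators\<close>

definition dominated :: "(nat set \<Rightarrow> ennreal) \<Rightarrow> nat measure set" where
  "dominated \<phi> = {\<mu>. sets \<mu> = UNIV \<and> finite {n. emeasure \<mu> {n} \<noteq> 0} \<and> (\<forall>B. emeasure \<mu> B \<le> \<phi> B)}"

text \<open>Pushing \<open>\<mu>\<close> forward along \<open>Suc\<close> matches the index shift in \<open>partial_sum_basis\<close>.\<close>

definition shift_weight :: "nat measure \<Rightarrow> nat \<Rightarrow> ennreal" where
  "shift_weight \<mu> n = emeasure \<mu> {m. Suc m = n}"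

text \<open>The point weights make every unit vector positive, including the one at
  \<open>0\<close>, which no shifted measure charges. They join the supremum as further members, and
  their geometric decay keeps their effect on tails negligible.\<close>

definition weights :: "(nat set \<Rightarrow> ennreal) \<Rightarrow> (nat \<Rightarrow> ennreal) set" where
  "weights \<phi> = shift_weight ` dominated \<phi> \<union> range (\<lambda>k n. if n = k then ennreal ((1/2)^k) else 0)"

definition phi_norm :: "(nat set \<Rightarrow> ennreal) \<Rightarrow> rseq \<Rightarrow> ennreal" where
  "phi_norm \<phi> x = (SUP w\<in>weights \<phi>. weighted_sum w x)"

text \<open>Countable additivity: the sets \<open>{m\<in>A. Suc m = n}\<close> have at most one
  point each and partition \<open>A\<close>.\<close>

lemma weighted_sum_shift_weight:
  assumes "sets \<mu> = UNIV"
  shows "weighted_sum (shift_weight \<mu>) (indicator (Suc ` A)) = emeasure \<mu> A"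
proof -
  have "shift_weight \<mu> n * ennreal \<bar>indicator (Suc ` A) n\<bar> = emeasure \<mu> {m\<in>A. Suc m = n}" for n
  proof (cases "n \<in> Suc ` A")
    case True
    then have "{m\<in>A. Suc m = n} = {m. Suc m = n}" by auto
    with True show ?thesis by (simp add: shift_weight_def)
  next
    case False
    then have "{m\<in>A. Suc m = n} = {}" by auto
    with False show ?thesis unfolding \<open>{m\<in>A. Suc m = n} = {}\<close> by simp
  qed
  then have "weighted_sum (shift_weight \<mu>) (indicator (Suc ` A)) = (\<Sum>n. emeasure \<mu> {m\<in>A. Suc m = n})"
    by (simp add: weighted_sum_def)
  also have "\<dots> = emeasure \<mu> (\<Union>n. {m\<in>A. Suc m = n})"
    using assms by (intro suminf_emeasure) (auto simp: disjoint_family_on_def)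
  also have "(\<Union>n. {m\<in>A. Suc m = n}) = A" by auto
  finally show ?thesis .
qed

lemma solid_norm_phi_norm:
  assumes "submeasure \<phi>"
  shows "solid_norm (phi_norm \<phi>)"
  unfolding phi_norm_def
proof (rule solid_norm_SUP)
  show "\<exists>w\<in>weights \<phi>. w n > 0" for n
    by (rule bexI[of _ "\<lambda>i. if i = n then ennreal ((1/2)^n) else 0"]) (auto simp: weights_def)
  show "(SUP w\<in>weights \<phi>. w n) < top" for n
  proof -
    \<comment> \<open>Domination bounds the shifted measures, and \<open>1\<close> bounds the point
      weights; the sum covers both cases.\<close>
    have "w n \<le> \<phi> {m. Suc m = n} + 1" if "w \<in> weights \<phi>" for w
    proof -
      from that consider "w n \<le> \<phi> {m. Suc m = n}" | "w n \<le> 1"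
        by (auto simp: weights_def dominated_def shift_weight_def power_le_one split: if_splits)
      then show ?thesis by cases (auto intro: add_increasing add_increasing2)
    qed
    then have "(SUP w\<in>weights \<phi>. w n) \<le> \<phi> {m. Suc m = n} + 1"
      by (rule SUP_least)
    also have "\<dots> < top"
    proof (cases n)
      case 0
      then show ?thesis using assms by (simp add: submeasure_def)
    next
      case (Suc k)
      then have "{m. Suc m = n} = {k}" by auto
      with assms show ?thesis by (simp add: submeasure_def)
    qed
    finally show ?thesis .
  qed
qed

text \<open>Non-pathology enters here: the dominated measures recover all of
  \<open>\<phi> A\<close>, and each of them supplies a weight.\<close>

lemma phi_le_phi_norm:
  assumes "nonpathological \<phi>"
  shows "\<phi> A \<le> phi_norm \<phi> (indicator (Suc ` A))"
proof -
  have "\<phi> A = (SUP \<mu>\<in>dominated \<phi>. emeasure \<mu> A)"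
    using assms unfolding nonpathological_def dominated_def by (rule spec)
  also have "\<dots> \<le> phi_norm \<phi> (indicator (Suc ` A))"
    unfolding phi_norm_def
  proof (rule SUP_least)
    fix \<mu> assume \<mu>: "\<mu> \<in> dominated \<phi>"
    then have "emeasure \<mu> A = weighted_sum (shift_weight \<mu>) (indicator (Suc ` A))"
      by (simp add: dominated_def weighted_sum_shift_weight)
    also have "\<dots> \<le> (SUP w\<in>weights \<phi>. weighted_sum w (indicator (Suc ` A)))"
      using \<mu> by (intro SUP_upper) (simp add: weights_def)
    finally show "emeasure \<mu> A \<le> \<dots>" .
  qed
  finally show ?thesis .
qed

text \<open>Dominated measures give at most \<open>\<phi> A\<close>; a point weight gives at most
  its own mass, and only points from \<open>n\<close> on are met.\<close>

lemma phi_norm_le: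
  assumes "A \<subseteq> {n..}"
  shows "phi_norm \<phi> (indicator (Suc ` A)) \<le> \<phi> A + ennreal ((1/2)^n)"
  unfolding phi_norm_def
proof (rule SUP_least)
  fix w assume "w \<in> weights \<phi>"
  then consider \<mu> where "\<mu> \<in> dominated \<phi>" "w = shift_weight \<mu>"
    | k where "w = (\<lambda>n. if n = k then ennreal ((1/2)^k) else 0)"
    by (auto simp: weights_def)
  then show "weighted_sum w (indicator (Suc ` A)) \<le> \<phi> A + ennreal ((1/2)^n)"
  proof cases
    case 1
    then show ?thesis by (simp add: dominated_def weighted_sum_shift_weight add_increasing2)
  next
    case 2
    have "weighted_sum w (indicator (Suc ` A)) = (\<Sum>i\<in>{k}. w i * ennreal \<bar>indicator (Suc ` A) i\<bar>)"
      unfolding weighted_sum_def by (rule suminf_finite) (auto simp: 2)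
    also have "\<dots> \<le> ennreal ((1/2)^n)"
    proof (cases "k \<in> Suc ` A")
      case True
      with assms have "n \<le> k" by auto
      then have "(1/2 :: real)^k \<le> (1/2)^n" by (intro power_decreasing) auto
      then show ?thesis by (simp add: 2 True ennreal_leI)
    qed simp
    finally show ?thesis by (simp add: add_increasing)
  qed
qed

section \<open>Identification of the critical ideal\<close>

theorem theorem7p1:
  fixes I :: "nat set set"
  assumes "nonpathological_analytic_P_ideal I"
  shows "\<exists>(X :: rseq set) (N :: rseq \<Rightarrow> real) (a :: system).
           banach_seq_space X N \<and>
           simple_over X N a unit_system \<and>
           critical_ideal X N a = I"
proof -
  obtain \<phi> where \<phi>: "submeasure \<phi>" "nonpathological \<phi>" and I: "I = Exh \<phi>" "nat_ideal I"
    using assms by (auto simp: nonpathological_analytic_P_ideal_def P_ideal_def)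
  interpret solid_norm "phi_norm \<phi>" by (rule solid_norm_phi_norm[OF \<phi>(1)])
  have level: "{n. \<bar>x (Suc n)\<bar> \<ge> e} \<in> I" if x: "x \<in> X" and "e > 0" for x and e :: real
  proof -
    let ?A = "{n. \<bar>x (Suc n)\<bar> \<ge> e}"
    \<comment> \<open>Division by \<open>e\<close> lifts the entries over the level set to at least
      \<open>1\<close>, so the tail dominates the indicator. It starts at \<open>Suc n\<close>
      because the points from \<open>n\<close> on are shifted by one.\<close>
    let ?t = "\<lambda>n. seq_scale (1/e) (restr {Suc n..} x)"
    have "(\<lambda>n. phi_norm \<phi> (restr {n..} (seq_scale (1/e) x))) \<longlonglongrightarrow> 0"
      using X_scale[OF x] by (simp add: X_def)
    then have lim: "(\<lambda>n. phi_norm \<phi> (?t n)) \<longlonglongrightarrow> 0"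
      unfolding restr_scale by (rule LIMSEQ_Suc)
    have le: "\<phi> (?A - {..<n}) \<le> phi_norm \<phi> (?t n)" for n
    proof -
      have "\<phi> (?A - {..<n}) \<le> phi_norm \<phi> (indicator (Suc ` (?A - {..<n})))"
        by (rule phi_le_phi_norm[OF \<phi>(2)])
      also have "\<dots> \<le> phi_norm \<phi> (?t n)"
        using \<open>e > 0\<close> by (intro mono) (auto simp: indicator_def restr_apply)
      finally show ?thesis .
    qed
    have "(\<lambda>n. \<phi> (?A - {..<n})) \<longlonglongrightarrow> 0"
      by (rule tendsto_sandwich[OF _ _ tendsto_const lim]) (auto simp: le)
    then show ?thesis by (simp add: I Exh_def)
  qed
  have ind: "indicator (Suc ` A) \<in> X" if "A \<in> I" for A
  proof -
    have "(\<lambda>n. \<phi> (A - {..<n}) + ennreal ((1/2)^n)) \<longlonglongrightarrow> 0 + ennreal 0"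
      using that by (intro tendsto_add tendsto_ennrealI LIMSEQ_realpow_zero) (auto simp: I Exh_def)
    then have lim: "(\<lambda>n. \<phi> (A - {..<n}) + ennreal ((1/2)^n)) \<longlonglongrightarrow> 0" by simp
    \<comment> \<open>Cutting at \<open>Suc n\<close> after the shift is cutting at \<open>n\<close>
      before it, which matches the tails in \<open>Exh\<close>.\<close>
    have tail: "restr {Suc n..} (indicator (Suc ` A)) = indicator (Suc ` (A - {..<n}))" for n
      by (auto simp: restr_apply indicator_def fun_eq_iff)
    have le: "phi_norm \<phi> (restr {Suc n..} (indicator (Suc ` A)))
        \<le> \<phi> (A - {..<n}) + ennreal ((1/2)^n)" for n
      unfolding tail by (rule phi_norm_le) auto
    have "(\<lambda>n. phi_norm \<phi> (restr {Suc n..} (indicator (Suc ` A)))) \<longlonglongrightarrow> 0"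
      by (rule tendsto_sandwich[OF _ _ tendsto_const lim]) (auto simp: le)
    then show ?thesis by (auto simp: X_def intro: LIMSEQ_imp_Suc)
  qed
  have iff: "ideal_schauder_basis J X N basis \<longleftrightarrow> I \<subseteq> J" if J: "nat_ideal J" for J
  proof
    assume S: "ideal_schauder_basis J X N basis"
    show "I \<subseteq> J"
    proof
      fix A assume "A \<in> I"
      with S ind[of A] ideal_schauder_basis_basis_iff[OF J]
      \<comment> \<open>Every \<open>A\<close> in \<open>I\<close> is itself a level set, that of
        its shifted indicator at level \<open>1\<close>.\<close>
      have "{n. \<bar>indicator (Suc ` A) (Suc n)\<bar> \<ge> (1::real)} \<in> J" by auto
      also have "{n. \<bar>indicator (Suc ` A) (Suc n)\<bar> \<ge> (1::real)} = A"
        by (auto simp: indicator_def)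
      finally show "A \<in> J" .
    qed
  qed (use level ideal_schauder_basis_basis_iff[OF J] in auto)
  \<comment> \<open>Taking \<open>J\<close> to be \<open>I\<close> and then the critical ideal gives
    the two inclusions.\<close>
  have "critical_ideal X N basis = I"
    using iff ideal_schauder_basis_iff nat_ideal_critical_ideal I(2)
    by (meson order.refl subset_antisym)
  then show ?thesis using banach simple_over_basis by blast
qed

end
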